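(* Let $p,q$ be distinct primes and for $m,n\ge 0$ let $s(m,n)$ denote the number of saturated $C_{p^mq^n}$-transfer systems. Let $m,n\ge 0$. Then \[ s(m,n+1)=s(m,n)+\sum_{k=0}^{m}\binom{m+1}{k}s(k,n). \]
   Context: $C_k$ denotes the cyclic group of order $k$, and $\mathrm{Sub}(G)$ the lattice of subgroups of a finite group $G$. For an Abelian finite group $G$, a $G$-transfer system is a relation $\to$ on $\mathrm{Sub}(G)$ refining inclusion ($K\to H$ implies $K\le H$) such that: $H\to H$ for all $H\le G$ (reflexivity); $L\to K$ and $K\to H$ imply $L\to H$ (transitivity); $K\to H$ and $M\le H$ imply $K\cap M\to M$ (closure under restriction). A transfer system is saturated if whenever $L\le K\le H\le G$ and two of the three relations $L\to K$, $L\to H$, $K\to H$ hold, then so does the third. The number $s(m,n)$ does not depend on the choice of the distinct primes $p,q$. *)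

theory Defs
  imports "HOL-Algebra.Elementary_Groups" "HOL-Computational_Algebra.Primes"
begin

definition Sub :: "('a, 'b) monoid_scheme \<Rightarrow> 'a set set"
  where "Sub G = {H. subgroup H G}"

text \<open>Relations are sets of pairs of subgroups, \<open>(K, H) \<in> R\<close> standing for \<open>K \<rightarrow> H\<close>. The first
  conjunct confines \<open>R\<close> to \<open>Sub G \<times> Sub G\<close>, so that distinct sets are distinct
  relations on \<open>Sub G\<close> and can be counted. The definitions are meant for finite Abelian groups;
  in the non-Abelian case closure under conjugation would have to be added.\<close>

definition transfer_system :: "('a, 'b) monoid_scheme \<Rightarrow> 'a set rel \<Rightarrow> bool"
  where "transfer_system G R \<longleftrightarrow>
    R \<subseteq> {(K, H). K \<in> Sub G \<and> H \<in> Sub G \<and> K \<subseteq> H} \<and>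
    (\<forall>H\<in>Sub G. (H, H) \<in> R) \<and>
    (\<forall>L K H. (L, K) \<in> R \<and> (K, H) \<in> R \<longrightarrow> (L, H) \<in> R) \<and>
    (\<forall>K H. \<forall>M\<in>Sub G. (K, H) \<in> R \<and> M \<subseteq> H \<longrightarrow> (K \<inter> M, M) \<in> R)"

definition saturated_transfer_system :: "('a, 'b) monoid_scheme \<Rightarrow> 'a set rel \<Rightarrow> bool"
  where "saturated_transfer_system G R \<longleftrightarrow>
    transfer_system G R \<and>
    (\<forall>L\<in>Sub G. \<forall>K\<in>Sub G. \<forall>H\<in>Sub G. L \<subseteq> K \<and> K \<subseteq> H \<longrightarrow>
      ((L, K) \<in> R \<and> (L, H) \<in> R \<longrightarrow> (K, H) \<in> R) \<and>
      ((L, K) \<in> R \<and> (K, H) \<in> R \<longrightarrow> (L, H) \<in> R) \<and>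
      ((L, H) \<in> R \<and> (K, H) \<in> R \<longrightarrow> (L, K) \<in> R))"

text \<open>The primes are explicit parameters. For positive \<open>k\<close>, \<open>integer_mod_group k\<close> is the
  cyclic group of order \<open>k\<close>.\<close>

definition num_saturated :: "nat \<Rightarrow> nat \<Rightarrow> nat \<Rightarrow> nat \<Rightarrow> nat"
  where "num_saturated p q m n =
    card {R. saturated_transfer_system (integer_mod_group (p ^ m * q ^ n)) R}"

end

theory Submission
  imports Defs "HOL-Library.Product_Order"
begin

text \<open>
  The subgroups of the cyclic group of order \<open>p^m q^n\<close> form the grid \<open>{0..m} \<times> {0..n}\<close>. A saturated transfer
  system is determined by the covering relations it contains. Closure under restriction makes the
  horizontal edges between columns \<open>i - 1\<close> and \<open>i\<close> an initial segment of rows, of length \<open>h i\<close>, and the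
  vertical edges between rows \<open>j\<close> and \<open>j + 1\<close> an initial segment of columns, of length \<open>v j\<close>; saturation
  says that no unit square has exactly three of its edges present. Adding a top row to the grid
  means choosing \<open>c = v n\<close> and the set \<open>S\<close> of those \<open>i > c\<close> whose horizontal edges now reach the new row.
  The columns in \<open>S\<close> can then be contracted, which leaves a code for a grid with \<open>m - |S|\<close>
  horizontal steps. Unless \<open>c = m + 1\<close>, the set \<open>T = {c} \<union> S\<close> is an arbitrary nonempty subset of
  \<open>{0..m}\<close>, which accounts for the binomial coefficients.
\<close>

subsection \<open>Counting codes\<close>

text \<open>Columns are indexed by an arbitrary set \<open>I \<subseteq> {1..M}\<close>, with \<open>0\<close> and \<open>M + 1\<close> for the empty and the
  full segment, so that contracting columns is a mere restriction of \<open>I\<close>.\<close>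

definition codes :: "nat \<Rightarrow> nat set \<Rightarrow> nat \<Rightarrow> ((nat \<Rightarrow> nat) \<times> (nat \<Rightarrow> nat)) set"
  where "codes M I n = {(h, v). h \<in> I \<rightarrow>\<^sub>E {..n + 1} \<and> v \<in> {..<n} \<rightarrow>\<^sub>E insert 0 (insert (M + 1) I) \<and>
    (\<forall>i\<in>I. \<forall>j<n. (h i = j + 1 \<longrightarrow> v j \<le> i) \<and> (v j = i \<longrightarrow> h i \<le> j + 1))}"

lemma finite_codes: "finite I \<Longrightarrow> finite (codes M I n)"
  by (rule finite_subset[of _ "(I \<rightarrow>\<^sub>E {..n + 1}) \<times> ({..<n} \<rightarrow>\<^sub>E insert 0 (insert (M + 1) I))"])
     (auto simp: codes_def intro!: finite_cartesian_product finite_PiE)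

lemma card_codes_0:
  assumes "finite I"
  shows "card (codes M I 0) = 2 ^ card I"
proof -
  have "codes M I 0 = (I \<rightarrow>\<^sub>E {..1}) \<times> {\<lambda>_. undefined}"
    by (auto simp: codes_def)
  then show ?thesis
    using assms by (simp add: card_cartesian_product card_PiE numeral_2_eq_2)
qed

text \<open>The codes that make a given choice \<open>(c, S)\<close> for the new row. Columns
  \<open>i < c\<close> are not recorded, because their edge in row \<open>n + 1\<close> is present
  exactly when the one in row \<open>n\<close> is.\<close>

definition codes_with :: "nat \<Rightarrow> nat set \<Rightarrow> nat \<Rightarrow> nat \<Rightarrow> nat set \<Rightarrow> ((nat \<Rightarrow> nat) \<times> (nat \<Rightarrow> nat)) set"
  where "codes_with M I n c S = {(h, v) \<in> codes M I (Suc n). v n = c \<and> {i\<in>I. c < i \<and> h i = n + 2} = S}"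

text \<open>A column \<open>i\<close> in \<open>S\<close> has all its horizontal edges, so its
  square conditions say only that no \<open>v j\<close> equals \<open>i\<close>. Dropping
  \<open>i\<close> from the index set expresses exactly this.\<close>

lemma card_codes_with:
  assumes c: "c \<in> insert 0 (insert (M + 1) I)" and S: "S \<subseteq> {i\<in>I. c < i}" and M: "I \<subseteq> {1..M}"
  shows "card (codes_with M I n c S) = card (codes M (I - S) n)"
proof -
  \<comment> \<open>Truncating to \<open>n + 1\<close> forgets the new row, but no information is lost outside \<open>S\<close>: a column \<open>i < c\<close>
    cannot have \<open>h i = n + 1\<close>, and a column \<open>i \<ge> c\<close> cannot have \<open>h i = n + 2\<close>.\<close>
  define F :: "(nat \<Rightarrow> nat) \<times> (nat \<Rightarrow> nat) \<Rightarrow> (nat \<Rightarrow> nat) \<times> (nat \<Rightarrow> nat)"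
    where "F = (\<lambda>(h, v). (restrict (\<lambda>i. min (h i) (n + 1)) (I - S), restrict v {..<n}))"
  \<comment> \<open>The inverse: columns in \<open>S\<close> become full, and to the left of
    \<open>c\<close> a truncated value \<open>n + 1\<close> can only stem from
    \<open>n + 2\<close>.\<close>
  define G :: "(nat \<Rightarrow> nat) \<times> (nat \<Rightarrow> nat) \<Rightarrow> (nat \<Rightarrow> nat) \<times> (nat \<Rightarrow> nat)"
    where "G = (\<lambda>(h, v). (restrict (\<lambda>i. if i \<in> S \<or> i < c \<and> h i = n + 1 then n + 2 else h i) I, v(n := c)))"
  have FG: "F x \<in> codes M (I - S) n \<and> G (F x) = x" if x: "x \<in> codes_with M I n c S" for x
  proof -
    obtain h v where [simp]: "x = (h, v)" by (cases x)
    have h: "h \<in> I \<rightarrow>\<^sub>E {..n + 2}" and v: "v \<in> {..<Suc n} \<rightarrow>\<^sub>E insert 0 (insert (M + 1) I)"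
      and hv: "\<And>i j. i \<in> I \<Longrightarrow> j < Suc n \<Longrightarrow> h i = j + 1 \<Longrightarrow> v j \<le> i"
      and vh: "\<And>i j. i \<in> I \<Longrightarrow> j < Suc n \<Longrightarrow> v j = i \<Longrightarrow> h i \<le> j + 1"
      and vn: "v n = c" and S': "\<And>i. i \<in> S \<longleftrightarrow> i \<in> I \<and> c < i \<and> h i = n + 2"
      using x by (auto simp: codes_with_def codes_def)
    \<comment> \<open>\<open>v j = i\<close> would bound \<open>h i\<close> by \<open>j + 1\<close>,
      whereas columns in \<open>S\<close> have \<open>h i = n + 2\<close>.\<close>
    have "v j \<notin> S" if "j < n" for j
      using vh[of "v j" j] S'[of "v j"] that by auto
    then have "restrict v {..<n} \<in> {..<n} \<rightarrow>\<^sub>E insert 0 (insert (M + 1) (I - S))"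
      using v by (auto simp: PiE_iff)
    moreover have "v j \<le> i" if "i \<in> I" "j < n" "min (h i) (n + 1) = j + 1" for i j
      using hv[of i j] that by (simp add: min_def split: if_splits)
    moreover have "min (h i) (n + 1) \<le> j + 1" if "i \<in> I" "j < n" "v j = i" for i j
      using vh[of i j] that by simp
    ultimately have 1: "F x \<in> codes M (I - S) n"
      unfolding codes_def F_def by simp
    have 2: "(if i \<in> S \<or> i < c \<and> min (h i) (n + 1) = n + 1 then n + 2 else min (h i) (n + 1)) = h i"
      if "i \<in> I" for i
    proof -
      have "h i \<le> n + 2" using h that by auto
      then show ?thesis using hv[of i n] vh[of i n] S'[of i] vn that
        by (cases i c rule: linorder_cases) (auto simp: min_def)
    qed
    have "fst (G (F x)) i = h i" for i
      using 2[of i] PiE_arb[OF h, of i]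
      by (cases "i \<in> I"; cases "i \<in> S") (simp_all add: F_def G_def split: if_splits)
    then have "fst (G (F x)) = h" by blast
    moreover have "snd (G (F x)) = v"
      using v vn by (auto simp: F_def G_def fun_eq_iff PiE_iff extensional_def)
    ultimately show ?thesis using 1 by (metis \<open>x = (h, v)\<close> prod.collapse)
  qed
  have GF: "G y \<in> codes_with M I n c S \<and> F (G y) = y" if y: "y \<in> codes M (I - S) n" for y
  proof -
    obtain h v where y': "y = (h, v)" by (cases y)
    have h: "h \<in> (I - S) \<rightarrow>\<^sub>E {..n + 1}" and v: "v \<in> {..<n} \<rightarrow>\<^sub>E insert 0 (insert (M + 1) (I - S))"
      and hv: "\<And>i j. i \<in> I - S \<Longrightarrow> j < n \<Longrightarrow> h i = j + 1 \<Longrightarrow> v j \<le> i"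
      and vh: "\<And>i j. i \<in> I - S \<Longrightarrow> j < n \<Longrightarrow> v j = i \<Longrightarrow> h i \<le> j + 1"
      using y by (auto simp: y' codes_def)
    define h' v' where "h' = restrict (\<lambda>i. if i \<in> S \<or> i < c \<and> h i = n + 1 then n + 2 else h i) I"
      and "v' = v(n := c)"
    have Gy: "G y = (h', v')" by (simp add: y' G_def h'_def v'_def)
    have hle: "h i \<le> n + 1" if "i \<in> I - S" for i
      using PiE_mem[OF h that] by simp
    \<comment> \<open>As the columns in \<open>S\<close> become full, no vertical segment may end in
      one of them.\<close>
    have vS: "v j \<notin> S" if "j < n" for j
    proof -
      have "v j \<in> insert 0 (insert (M + 1) (I - S))"
        using PiE_mem[OF v, of j] that by blast
      moreover have "0 \<notin> S" "M + 1 \<notin> S" using S M by fastforce+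
      ultimately show ?thesis by (metis Diff_iff insert_iff)
    qed
    have h': "h' \<in> I \<rightarrow>\<^sub>E {..Suc n + 1}"
    proof (rule PiE_I)
      show "h' i \<in> {..Suc n + 1}" if "i \<in> I" for i
        using hle[of i] that by (cases "i \<in> S") (simp_all add: h'_def)
    qed (simp add: h'_def)
    have v': "v' \<in> {..<Suc n} \<rightarrow>\<^sub>E insert 0 (insert (M + 1) I)"
    proof (rule PiE_I)
      show "v' j \<in> insert 0 (insert (M + 1) I)" if "j \<in> {..<Suc n}" for j
        using PiE_mem[OF v, of j] c that by (cases "j = n") (auto simp: v'_def)
      show "v' j = undefined" if "j \<notin> {..<Suc n}" for j
        using PiE_arb[OF v, of j] that by (simp add: v'_def)
    qed
    \<comment> \<open>In the new case \<open>j = n\<close>, the value \<open>n + 1\<close> survives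
      only at columns \<open>i\<close> with \<open>c \<le> i\<close>.\<close>
    have hv': "v' j \<le> i" if "i \<in> I" "j < Suc n" "h' i = j + 1" for i j
      using that hv[of i j] hle[of i] S by (auto simp: h'_def v'_def less_Suc_eq split: if_splits)
    \<comment> \<open>For \<open>j = n\<close> the column is \<open>c\<close> itself, which is
      neither in \<open>S\<close> nor left of \<open>c\<close>, so its value was not raised.\<close>
    have vh': "h' i \<le> j + 1" if "i \<in> I" "j < Suc n" "v' j = i" for i j
      using that vh[of i j] hle[of i] S vS[of j] by (auto simp: h'_def v'_def less_Suc_eq split: if_splits)
    have "c < i \<and> h' i = n + 2 \<longleftrightarrow> i \<in> S" if "i \<in> I" for i
      using that S hle[of i] by (cases "i \<in> S") (auto simp: h'_def)
    then have "{i\<in>I. c < i \<and> h' i = n + 2} = S"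
      using S by blast
    with h' v' hv' vh' have 1: "G y \<in> codes_with M I n c S"
      unfolding Gy codes_with_def codes_def by (auto simp: v'_def)
    have "fst (F (G y)) i = h i" for i
      using hle[of i] PiE_arb[OF h, of i] S
      by (cases "i \<in> I - S") (auto simp: Gy F_def h'_def)
    then have "fst (F (G y)) = h" by blast
    moreover have "snd (F (G y)) = v"
      using v by (auto simp: Gy F_def v'_def fun_eq_iff PiE_iff extensional_def)
    ultimately show ?thesis using 1 by (metis y' prod.collapse)
  qed
  have "bij_betw F (codes_with M I n c S) (codes M (I - S) n)"
    by (rule bij_betw_byWitness[where f' = G]) (use FG GF in auto)
  then show ?thesis by (rule bij_betw_same_card)
qed

text \<open>The claimed recurrence turned into a definition, started at the single-row count;
  \<open>n\<close> counts vertical and \<open>k\<close> horizontal steps.\<close>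

primrec num_codes :: "nat \<Rightarrow> nat \<Rightarrow> nat" where
  "num_codes 0 k = 2 ^ k"
| "num_codes (Suc n) k = num_codes n k + (\<Sum>j = 0..k. ((k + 1) choose j) * num_codes n j)"

text \<open>Codes are sorted by \<open>(c, S)\<close>. Contraction turns each class into the codes
  on \<open>I - S\<close>, to which the induction hypothesis applies because \<open>I\<close> is
  kept arbitrary.\<close>

lemma card_codes:
  assumes "I \<subseteq> {1..M}"
  shows "card (codes M I n) = num_codes n (card I)"
  using assms
proof (induction n arbitrary: I)
  case 0
  then show ?case by (simp add: card_codes_0 finite_subset)
next
  case (Suc n)
  have fin: "finite I" using Suc.prems finite_subset by blast
  let ?k = "card I" and ?T = "M + 1" and ?J = "insert 0 I"
  have notin: "0 \<notin> I" "?T \<notin> I" and fin0: "finite ?J" using Suc.prems fin by auto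
  define P where "P = (SIGMA c : insert 0 (insert ?T I). Pow {i\<in>I. c < i})"
  have finP: "finite P" unfolding P_def using fin by auto
  have un: "codes M I (Suc n) = (\<Union>(c, S)\<in>P. codes_with M I n c S)"
  proof (intro equalityI subsetI)
    fix x assume x: "x \<in> codes M I (Suc n)"
    obtain h v where hv: "x = (h, v)" by (cases x)
    have "v \<in> {..<Suc n} \<rightarrow>\<^sub>E insert 0 (insert ?T I)" using x by (simp add: hv codes_def)
    then have "v n \<in> insert 0 (insert ?T I)" by (rule PiE_mem) simp
    then have "(v n, {i\<in>I. v n < i \<and> h i = n + 2}) \<in> P" by (auto simp: P_def)
    moreover have "x \<in> codes_with M I n (v n) {i\<in>I. v n < i \<and> h i = n + 2}"
      using x by (simp add: hv codes_with_def)
    ultimately show "x \<in> (\<Union>(c, S)\<in>P. codes_with M I n c S)" by blast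
  qed (auto simp: codes_with_def)
  have "card (codes M I (Suc n)) = (\<Sum>(c, S)\<in>P. card (codes_with M I n c S))"
    unfolding un
    by (subst card_UN_disjoint)
       (auto simp: finP case_prod_beta codes_with_def
         intro: finite_subset[OF _ finite_codes[OF fin, of M "Suc n"]])
  also have "\<dots> = (\<Sum>(c, S)\<in>P. num_codes n (?k - card S))"
  proof (rule sum.cong[OF refl], clarify)
    fix c S assume "(c, S) \<in> P"
    then have c: "c \<in> insert 0 (insert ?T I)" and S: "S \<subseteq> {i\<in>I. c < i}"
      by (auto simp: P_def)
    then have "card (I - S) = ?k - card S"
      by (metis (no_types, lifting) card_Diff_subset fin finite_subset mem_Collect_eq subset_eq)
    then show "card (codes_with M I n c S) = num_codes n (?k - card S)"
      using card_codes_with[OF c S Suc.prems] Suc.IH[of "I - S"] Suc.prems by auto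
  qed
  \<comment> \<open>For \<open>c = M + 1\<close> no column lies to the right, so \<open>S\<close> is
    empty; this pair yields the separate first summand of the recurrence.\<close>
  also have "P = insert (?T, {}) (SIGMA c : ?J. Pow {i\<in>I. c < i})" (is "_ = insert _ ?Q")
  proof -
    have "P = {?T} \<times> Pow {i\<in>I. ?T < i} \<union> ?Q" unfolding P_def by blast
    moreover have "Pow {i\<in>I. ?T < i} = {{}}" using Suc.prems by auto
    ultimately show ?thesis by (simp only:) simp
  qed
  also have "(\<Sum>(c, S)\<in>insert (?T, {}) ?Q. num_codes n (?k - card S))
      = num_codes n ?k + (\<Sum>(c, S)\<in>?Q. num_codes n (?k - card S))"
    using notin fin by (subst sum.insert) auto
  \<comment> \<open>Since \<open>c\<close> lies below all of \<open>S\<close>, it is recovered as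
    the minimum of \<open>insert c S\<close>; the extra element accounts for
    \<open>?k + 1\<close>.\<close>
  also have "(\<Sum>(c, S)\<in>?Q. num_codes n (?k - card S)) = (\<Sum>T\<in>Pow ?J - {{}}. num_codes n (?k + 1 - card T))"
  proof (rule sum.reindex_bij_witness[where j = "\<lambda>(c, S). insert c S" and i = "\<lambda>T. (Min T, T - {Min T})"])
    fix T assume T: "T \<in> Pow ?J - {{}}"
    then have fT: "finite T" and "T \<noteq> {}" using fin0 finite_subset by auto
    then obtain c where c: "c = Min T" "c \<in> T" "\<And>i. i \<in> T \<Longrightarrow> c \<le> i" by auto
    have "T - {c} \<subseteq> {i\<in>I. c < i}"
    proof
      fix i assume "i \<in> T - {c}"
      then have "c < i" "i \<in> ?J" using c(3)[of i] T by auto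
      then show "i \<in> {i\<in>I. c < i}" by auto
    qed
    with T c(2) show "(case (Min T, T - {Min T}) of (c, S) \<Rightarrow> insert c S) = T"
      and "(Min T, T - {Min T}) \<in> ?Q"
      unfolding c(1)[symmetric] by auto
  next
    fix x assume "x \<in> ?Q"
    then obtain c S where x: "x = (c, S)" and c: "c \<in> ?J" and S: "S \<subseteq> I" "\<And>i. i \<in> S \<Longrightarrow> c < i" by auto
    have fS: "finite S" using S fin finite_subset by blast
    have "Min (insert c S) = c" using S fS by (intro Min_eqI) (auto simp: le_less)
    moreover have "c \<notin> S" using S by auto
    ultimately show "(Min (case x of (c, S) \<Rightarrow> insert c S),
         (case x of (c, S) \<Rightarrow> insert c S) - {Min (case x of (c, S) \<Rightarrow> insert c S)}) = x"
      and "num_codes n (?k + 1 - card (case x of (c, S) \<Rightarrow> insert c S)) = (case x of (c, S) \<Rightarrow> num_codes n (?k - card S))"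
      using fS by (simp_all add: x)
    show "(case x of (c, S) \<Rightarrow> insert c S) \<in> Pow ?J - {{}}"
      using c S(1) by (auto simp: x)
  qed
  \<comment> \<open>Here \<open>j\<close> is the number of elements of \<open>?J\<close> outside
    \<open>T\<close>; it is at most \<open>?k\<close> because \<open>T\<close> is nonempty.\<close>
  also have "\<dots> = (\<Sum>j = 0..?k. \<Sum>T\<in>{T\<in>Pow ?J - {{}}. ?k + 1 - card T = j}. num_codes n (?k + 1 - card T))"
  proof (rule sum.group[symmetric])
    show "(\<lambda>T. ?k + 1 - card T) ` (Pow ?J - {{}}) \<subseteq> {0..?k}"
    proof (rule image_subsetI)
      fix T assume "T \<in> Pow ?J - {{}}"
      then have "T \<subseteq> ?J" "T \<noteq> {}" by auto
      then have "card T > 0" by (meson card_gt_0_iff fin0 finite_subset)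
      then show "?k + 1 - card T \<in> {0..?k}" by auto
    qed
  qed (use fin in auto)
  also have "\<dots> = (\<Sum>j = 0..?k. ((?k + 1) choose j) * num_codes n j)"
  proof (rule sum.cong[OF refl])
    fix j assume j: "j \<in> {0..?k}"
    have cJ: "card ?J = ?k + 1" using notin fin by simp
    \<comment> \<open>As \<open>j\<close> is at most \<open>?k\<close>, the size
      \<open>?k + 1 - j\<close> is positive and hence forces \<open>T\<close> to be
      nonempty.\<close>
    have "{T\<in>Pow ?J - {{}}. ?k + 1 - card T = j} = {T. T \<subseteq> ?J \<and> card T = ?k + 1 - j}"
    proof (rule Set.set_eqI)
      fix T
      have "card T \<le> ?k + 1" "card T = 0 \<longleftrightarrow> T = {}" if "T \<subseteq> ?J"
        using that card_mono[OF fin0 that] cJ finite_subset[OF that fin0] by simp_all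
      then show "T \<in> {T\<in>Pow ?J - {{}}. ?k + 1 - card T = j} \<longleftrightarrow> T \<in> {T. T \<subseteq> ?J \<and> card T = ?k + 1 - j}"
        using j by (cases "T \<subseteq> ?J") auto
    qed
    then have "card {T\<in>Pow ?J - {{}}. ?k + 1 - card T = j} = (?k + 1) choose (?k + 1 - j)"
      using n_subsets[OF fin0, of "?k + 1 - j"] cJ by simp
    also have "\<dots> = (?k + 1) choose j"
      using j by (intro binomial_symmetric[symmetric]) auto
    finally show "(\<Sum>T\<in>{T\<in>Pow ?J - {{}}. ?k + 1 - card T = j}. num_codes n (?k + 1 - card T))
      = ((?k + 1) choose j) * num_codes n j" by simp
  qed
  finally show ?case by simp
qed

subsection \<open>Saturated transfer systems on lattices\<close>

text \<open>Of the three saturation conditions only one is listed: the second is transitivity, and the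
  third is restriction from \<open>z\<close> to \<open>y\<close> when \<open>x \<le> y \<le> z\<close>, since then the meet of \<open>x\<close> and \<open>y\<close> is \<open>x\<close>.\<close>

definition saturated_on :: "'a set \<Rightarrow> ('a \<Rightarrow> 'a \<Rightarrow> bool) \<Rightarrow> ('a \<Rightarrow> 'a \<Rightarrow> 'a) \<Rightarrow> 'a rel \<Rightarrow> bool"
  where "saturated_on A leq glb R \<longleftrightarrow>
    R \<subseteq> {(x, y). x \<in> A \<and> y \<in> A \<and> leq x y} \<and> (\<forall>x\<in>A. (x, x) \<in> R) \<and> trans R \<and>
    (\<forall>x y. \<forall>z\<in>A. (x, y) \<in> R \<and> leq z y \<longrightarrow> (glb x z, z) \<in> R) \<and>
    (\<forall>x y z. (x, y) \<in> R \<and> (x, z) \<in> R \<and> leq y z \<longrightarrow> (y, z) \<in> R)"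

text \<open>Every clause concerns elements of the carrier only, so it can be written with bounded
  quantifiers, and these pass through the bijection \<open>f\<close>.\<close>

lemma saturated_on_transport:
  assumes bij: "bij_betw f A B"
    and le: "\<And>x y. x \<in> A \<Longrightarrow> y \<in> A \<Longrightarrow> leq' (f x) (f y) \<longleftrightarrow> leq x y"
    and meet: "\<And>x y. x \<in> A \<Longrightarrow> y \<in> A \<Longrightarrow> glb x y \<in> A \<and> f (glb x y) = glb' (f x) (f y)"
    and R: "R \<subseteq> A \<times> A"
  shows "saturated_on B leq' glb' (map_prod f f ` R) \<longleftrightarrow> saturated_on A leq glb R"
proof -
  define Q where "Q = map_prod f f ` R"
  have inj: "inj_on f A" and B: "B = f ` A" using bij by (auto simp: bij_betw_def)
  have RA: "x \<in> A" "y \<in> A" if "(x, y) \<in> R" for x y using R that by auto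
  have fR: "(f x, f y) \<in> Q \<longleftrightarrow> (x, y) \<in> R" if "x \<in> A" "y \<in> A" for x y
  proof
    assume "(f x, f y) \<in> Q"
    then obtain u w where uw: "(u, w) \<in> R" "f x = f u" "f y = f w" by (auto simp: Q_def)
    then have "x = u" "y = w" using RA[OF uw(1)] that inj_onD[OF inj] by blast+
    then show "(x, y) \<in> R" using uw(1) by simp
  qed (auto simp: Q_def)
  have all: "(\<forall>x\<in>B. P x) \<longleftrightarrow> (\<forall>x\<in>A. P (f x))" for P by (auto simp: B)
  have RB: "x \<in> B" "y \<in> B" if "(x, y) \<in> Q" for x y using R that by (auto simp: Q_def B)
  have 1: "Q \<subseteq> {(x, y). x \<in> B \<and> y \<in> B \<and> leq' x y} \<longleftrightarrow> R \<subseteq> {(x, y). x \<in> A \<and> y \<in> A \<and> leq x y}"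
  proof -
    have "Q \<subseteq> {(x, y). x \<in> B \<and> y \<in> B \<and> leq' x y} \<longleftrightarrow> (\<forall>x\<in>B. \<forall>y\<in>B. (x, y) \<in> Q \<longrightarrow> leq' x y)"
      using RB by blast
    also have "\<dots> \<longleftrightarrow> (\<forall>x\<in>A. \<forall>y\<in>A. (x, y) \<in> R \<longrightarrow> leq x y)"
      unfolding all by (simp add: fR le cong: ball_cong)
    also have "\<dots> \<longleftrightarrow> R \<subseteq> {(x, y). x \<in> A \<and> y \<in> A \<and> leq x y}"
      using RA by blast
    finally show ?thesis .
  qed
  have 2: "(\<forall>x\<in>B. (x, x) \<in> Q) \<longleftrightarrow> (\<forall>x\<in>A. (x, x) \<in> R)"
    unfolding all by (simp add: fR cong: ball_cong)
  have 3: "trans Q \<longleftrightarrow> trans R"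
  proof -
    have "trans Q \<longleftrightarrow> (\<forall>x\<in>B. \<forall>y\<in>B. \<forall>z\<in>B. (x, y) \<in> Q \<longrightarrow> (y, z) \<in> Q \<longrightarrow> (x, z) \<in> Q)"
      unfolding trans_def using RB by blast
    also have "\<dots> \<longleftrightarrow> (\<forall>x\<in>A. \<forall>y\<in>A. \<forall>z\<in>A. (x, y) \<in> R \<longrightarrow> (y, z) \<in> R \<longrightarrow> (x, z) \<in> R)"
      unfolding all by (simp add: fR cong: ball_cong)
    also have "\<dots> \<longleftrightarrow> trans R"
      unfolding trans_def using RA by blast
    finally show ?thesis .
  qed
  have 4: "(\<forall>x y. \<forall>z\<in>B. (x, y) \<in> Q \<and> leq' z y \<longrightarrow> (glb' x z, z) \<in> Q) \<longleftrightarrow>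
      (\<forall>x y. \<forall>z\<in>A. (x, y) \<in> R \<and> leq z y \<longrightarrow> (glb x z, z) \<in> R)"
  proof -
    have "(\<forall>x y. \<forall>z\<in>B. (x, y) \<in> Q \<and> leq' z y \<longrightarrow> (glb' x z, z) \<in> Q) \<longleftrightarrow>
        (\<forall>x\<in>B. \<forall>y\<in>B. \<forall>z\<in>B. (x, y) \<in> Q \<longrightarrow> leq' z y \<longrightarrow> (glb' x z, z) \<in> Q)"
      using RB by blast
    also have "\<dots> \<longleftrightarrow> (\<forall>x\<in>A. \<forall>y\<in>A. \<forall>z\<in>A. (x, y) \<in> R \<longrightarrow> leq z y \<longrightarrow> (glb x z, z) \<in> R)"
      unfolding all by (simp add: fR le conjunct1[OF meet] conjunct2[OF meet, symmetric] cong: ball_cong)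
    also have "\<dots> \<longleftrightarrow> (\<forall>x y. \<forall>z\<in>A. (x, y) \<in> R \<and> leq z y \<longrightarrow> (glb x z, z) \<in> R)"
      using RA by blast
    finally show ?thesis .
  qed
  have 5: "(\<forall>x y z. (x, y) \<in> Q \<and> (x, z) \<in> Q \<and> leq' y z \<longrightarrow> (y, z) \<in> Q) \<longleftrightarrow>
      (\<forall>x y z. (x, y) \<in> R \<and> (x, z) \<in> R \<and> leq y z \<longrightarrow> (y, z) \<in> R)"
  proof -
    have "(\<forall>x y z. (x, y) \<in> Q \<and> (x, z) \<in> Q \<and> leq' y z \<longrightarrow> (y, z) \<in> Q) \<longleftrightarrow>
        (\<forall>x\<in>B. \<forall>y\<in>B. \<forall>z\<in>B. (x, y) \<in> Q \<longrightarrow> (x, z) \<in> Q \<longrightarrow> leq' y z \<longrightarrow> (y, z) \<in> Q)"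
      using RB by blast
    also have "\<dots> \<longleftrightarrow> (\<forall>x\<in>A. \<forall>y\<in>A. \<forall>z\<in>A. (x, y) \<in> R \<longrightarrow> (x, z) \<in> R \<longrightarrow> leq y z \<longrightarrow> (y, z) \<in> R)"
      unfolding all by (simp add: fR le cong: ball_cong)
    also have "\<dots> \<longleftrightarrow> (\<forall>x y z. (x, y) \<in> R \<and> (x, z) \<in> R \<and> leq y z \<longrightarrow> (y, z) \<in> R)"
      using RA by blast
    finally show ?thesis .
  qed
  show ?thesis unfolding saturated_on_def Q_def[symmetric] 1 2 3 4 5 ..
qed

lemma card_saturated_on_transport:
  assumes bij: "bij_betw f A B"
    and le: "\<And>x y. x \<in> A \<Longrightarrow> y \<in> A \<Longrightarrow> leq' (f x) (f y) \<longleftrightarrow> leq x y"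
    and meet: "\<And>x y. x \<in> A \<Longrightarrow> y \<in> A \<Longrightarrow> glb x y \<in> A \<and> f (glb x y) = glb' (f x) (f y)"
  shows "card {R. saturated_on B leq' glb' R} = card {R. saturated_on A leq glb R}"
proof -
  have AA: "R \<in> Pow (A \<times> A)" if "saturated_on A leq glb R" for R
    using that unfolding saturated_on_def by auto
  have BB: "R \<in> Pow (B \<times> B)" if "saturated_on B leq' glb' R" for R
    using that unfolding saturated_on_def by auto
  have "bij_betw (map_prod f f) (A \<times> A) (B \<times> B)" by (rule bij_betw_map_prod[OF bij bij])
  then have b: "bij_betw ((`) (map_prod f f)) (Pow (A \<times> A)) (Pow (B \<times> B))" by (rule bij_betw_Pow)
  have "(`) (map_prod f f) ` {R. saturated_on A leq glb R} = {R. saturated_on B leq' glb' R}" (is "?L = ?R")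
  proof (intro equalityI subsetI)
    fix R assume "R \<in> ?L"
    then obtain R' where "R = map_prod f f ` R'" "saturated_on A leq glb R'" by auto
    then show "R \<in> ?R" using saturated_on_transport[where leq' = leq' and glb' = glb', OF bij le meet, of R'] AA[of R'] by simp
  next
    fix R assume R: "R \<in> ?R"
    then obtain R' where R': "R = map_prod f f ` R'" "R' \<subseteq> A \<times> A"
      using bij_betw_imp_surj_on[OF b] BB[of R] by (smt (verit) PowD image_iff mem_Collect_eq)
    then show "R \<in> ?L" using R saturated_on_transport[where leq' = leq' and glb' = glb', OF bij le meet R'(2)] by simp
  qed
  then have "bij_betw ((`) (map_prod f f)) {R. saturated_on A leq glb R} {R. saturated_on B leq' glb' R}"
    using b AA by (metis (no_types, lifting) bij_betw_subset mem_Collect_eq subsetI)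
  then show ?thesis by (simp add: bij_betw_same_card)
qed

subsection \<open>Codes of saturated systems on a grid\<close>

text \<open>Points are pairs (column, row). The unit edges on the upper and right sides of the
  rectangle are required. Horizontal step \<open>i\<close> ends in column \<open>i\<close> while
  vertical step \<open>j\<close> starts in row \<open>j\<close>, hence the two kinds of
  interval.\<close>

definition rel_of :: "nat \<Rightarrow> nat \<Rightarrow> (nat \<Rightarrow> nat) \<times> (nat \<Rightarrow> nat) \<Rightarrow> (nat \<times> nat) rel"
  where "rel_of m n = (\<lambda>(h, v). {((a, b), (c, d)) | a b c d. a \<le> c \<and> c \<le> m \<and> b \<le> d \<and> d \<le> n \<and>
    (\<forall>i\<in>{a<..c}. d < h i) \<and> (\<forall>j\<in>{b..<d}. c < v j)})"

lemma mem_rel_of: "((a, b), (c, d)) \<in> rel_of m n (h, v) \<longleftrightarrow> a \<le> c \<and> c \<le> m \<and> b \<le> d \<and> d \<le> n \<and>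
    (\<forall>i\<in>{a<..c}. d < h i) \<and> (\<forall>j\<in>{b..<d}. c < v j)"
  by (simp add: rel_of_def)

text \<open>Restriction and saturation only weaken the required inequalities; the square conditions
  enter through transitivity.\<close>

lemma saturated_rel_of:
  assumes "(h, v) \<in> codes m {1..m} n"
  shows "saturated_on ({..m} \<times> {..n}) (\<le>) inf (rel_of m n (h, v))"
proof -
  have hv: "v j \<le> i" if "i \<in> {1..m}" "j < n" "h i = j + 1" for i j
    using assms that unfolding codes_def by auto
  have vh: "h i \<le> j + 1" if "i \<in> {1..m}" "j < n" "v j = i" for i j
    using assms that unfolding codes_def by auto
  \<comment> \<open>Climb row by row: a square with its lower, left and right edges also has its
    upper one, since \<open>h i = j + 1\<close> would force \<open>v j \<le> i\<close>.\<close>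
  have push_h: "f < h i" if "d < h i" "d \<le> f" "f \<le> n" "i \<in> {1..m}" "\<And>j. d \<le> j \<Longrightarrow> j < f \<Longrightarrow> i < v j" for d f i
    using that(2,3,5)
  proof (induction f rule: dec_induct)
    case base show ?case by fact
  next
    case (step j)
    then have "j < h i" by simp
    moreover have "i < v j" using step by simp
    ultimately show ?case using hv[OF that(4), of j] step by fastforce
  qed
  \<comment> \<open>The mirror image: a square with its left, lower and upper edges also has its
    right one.\<close>
  have push_v: "e < v j" if "c < v j" "c \<le> e" "e \<le> m" "j < n" "\<And>i. c < i \<Longrightarrow> i \<le> e \<Longrightarrow> j + 1 < h i" for c e j
    using that(2,3,5)
  proof (induction e rule: dec_induct)
    case base show ?case by fact
  next
    case (step i)
    then have "i < v j" by simp
    moreover have "j + 1 < h (Suc i)" using step by simp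
    ultimately show ?case using vh[of "Suc i" j] step that(4) by fastforce
  qed
  have "((a, b), (e, f)) \<in> rel_of m n (h, v)"
    if 1: "((a, b), (c, d)) \<in> rel_of m n (h, v)" and 2: "((c, d), (e, f)) \<in> rel_of m n (h, v)"
    for a b c d e f
  proof -
    \<comment> \<open>For \<open>i \<le> c\<close> the first pair only gives \<open>d < h i\<close>;
      the vertical edges of the second pair, which extend to column \<open>e\<close>, lift this to
      \<open>f\<close>.\<close>
    have H: "f < h i" if "a < i" "i \<le> e" for i
    proof (cases "i \<le> c")
      case True
      show ?thesis
      proof (rule push_h[of d])
        show "i < v j" if "d \<le> j" "j < f" for j
        proof -
          have "c \<le> e" "e < v j" using 2 that by (simp_all add: mem_rel_of)
          then show ?thesis using True by simp
        qed
      qed (use 1 2 that True in \<open>auto simp: mem_rel_of\<close>)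
    qed (use 2 that in \<open>auto simp: mem_rel_of\<close>)
    have V: "e < v j" if "b \<le> j" "j < f" for j
    proof (cases "j < d")
      case True
      show ?thesis
      proof (rule push_v[of c])
        show "j + 1 < h i" if "c < i" "i \<le> e" for i
        proof -
          have "d \<le> f" "f < h i" using 2 that by (simp_all add: mem_rel_of)
          then show ?thesis using True by simp
        qed
      qed (use 1 2 that True in \<open>auto simp: mem_rel_of\<close>)
    qed (use 2 that in \<open>auto simp: mem_rel_of\<close>)
    show ?thesis using 1 2 H V by (simp add: mem_rel_of)
  qed
  then have trans: "trans (rel_of m n (h, v))"
    unfolding trans_def by (simp only: split_paired_All) blast
  have restr: "((inf a x, inf b y), (x, y)) \<in> rel_of m n (h, v)"
    if R: "((a, b), (c, d)) \<in> rel_of m n (h, v)" and "x \<le> c" "y \<le> d" for a b c d x y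
  proof -
    have "y < h i" if "a < i" "i \<le> x" for i
    proof -
      have "d < h i" using R that \<open>x \<le> c\<close> by (simp add: mem_rel_of)
      then show ?thesis using \<open>y \<le> d\<close> by simp
    qed
    moreover have "x < v j" if "b \<le> j" "j < y" for j
    proof -
      have "c < v j" using R that \<open>y \<le> d\<close> by (simp add: mem_rel_of)
      then show ?thesis using \<open>x \<le> c\<close> by simp
    qed
    ultimately show ?thesis
      using R that(2,3) unfolding mem_rel_of by (auto simp: inf_min min_less_iff_disj min_le_iff_disj)
  qed
  have sub: "rel_of m n (h, v) \<subseteq> {(x, y). x \<in> {..m} \<times> {..n} \<and> y \<in> {..m} \<times> {..n} \<and> x \<le> y}"
    by (auto simp: rel_of_def)
  have sat: "((c, d), (e, f)) \<in> rel_of m n (h, v)"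
    if "((a, b), (c, d)) \<in> rel_of m n (h, v)" "((a, b), (e, f)) \<in> rel_of m n (h, v)" "c \<le> e" "d \<le> f"
    for a b c d e f
    using that by (simp add: mem_rel_of)
  have restr': "(inf x z, z) \<in> rel_of m n (h, v)" if "(x, y) \<in> rel_of m n (h, v)" "z \<le> y" for x y z
    using that by (cases x; cases y; cases z) (auto intro: restr)
  have sat': "(y, z) \<in> rel_of m n (h, v)"
    if "(x, y) \<in> rel_of m n (h, v)" "(x, z) \<in> rel_of m n (h, v)" "y \<le> z" for x y z
    using that by (cases x; cases y; cases z) (auto intro: sat)
  have refl: "(x, x) \<in> rel_of m n (h, v)" if "x \<in> {..m} \<times> {..n}" for x
    using that by (cases x) (simp add: mem_rel_of)
  show ?thesis
    unfolding saturated_on_def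
    by (intro conjI ballI allI impI; (elim conjE)?)
       (rule sub, erule refl, rule trans, erule (1) restr', erule (2) sat')
qed

lemma trans_chain:
  fixes f :: "nat \<Rightarrow> 'a" and a c :: nat
  assumes "trans R" "a \<le> c" "(f a, f a) \<in> R" "\<And>i. a < i \<Longrightarrow> i \<le> c \<Longrightarrow> (f (i - 1), f i) \<in> R"
  shows "(f a, f c) \<in> R"
  using assms(2,4)
proof (induction c rule: dec_induct)
  case base show ?case by (rule assms(3))
next
  case (step k)
  then have "(f a, f k) \<in> R" "(f k, f (Suc k)) \<in> R" using step.prems[of "Suc k"] by auto
  then show ?case using assms(1) by (blast dest: transD)
qed

text \<open>The length is the least point where \<open>P\<close> fails; it will serve as a value
  \<open>h i\<close> or \<open>v j\<close> of a code.\<close>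

lemma downward_closed_eq_lessThan:
  fixes n :: nat
  assumes "\<And>j k. P k \<Longrightarrow> j \<le> k \<Longrightarrow> P j" and "\<And>j. P j \<Longrightarrow> j \<le> n"
  shows "\<exists>a\<le>n + 1. \<forall>j. P j \<longleftrightarrow> j < a"
proof -
  define a where "a = (LEAST j. \<not> P j)"
  have "\<not> P (n + 1)" using assms(2)[of "n + 1"] by auto
  then have "\<not> P a" "a \<le> n + 1" unfolding a_def by (rule LeastI, rule Least_le)
  moreover have "P j" if "j < a" for j using not_less_Least that unfolding a_def by blast
  ultimately show ?thesis using assms(1) by (meson not_le)
qed

text \<open>Restriction makes the unit edges initial segments, and saturation on unit squares gives
  the code conditions. The unit edges determine \<open>R\<close>: restriction and saturation split a
  pair into edges, transitivity reassembles it.\<close>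

lemma saturated_imp_rel_of:
  assumes "saturated_on ({..m} \<times> {..n}) (\<le>) inf R"
  shows "\<exists>x\<in>codes m {1..m} n. R = rel_of m n x"
proof -
  have sub: "R \<subseteq> {(x, y). x \<in> {..m} \<times> {..n} \<and> y \<in> {..m} \<times> {..n} \<and> x \<le> y}"
    using assms unfolding saturated_on_def by (rule conjunct1)
  have bnd: "a \<le> c \<and> b \<le> d \<and> c \<le> m \<and> d \<le> n" if "((a, b), (c, d)) \<in> R" for a b c d
    using subsetD[OF sub that] by simp
  have refl: "((a, b), (a, b)) \<in> R" if "a \<le> m" "b \<le> n" for a b
    using assms that unfolding saturated_on_def by simp
  have trans: "trans R" using assms unfolding saturated_on_def by simp
  have restr0: "(inf x z, z) \<in> R" if "(x, y) \<in> R" "z \<in> {..m} \<times> {..n}" "z \<le> y" for x y z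
    using assms that unfolding saturated_on_def by blast
  have sat0: "(y, z) \<in> R" if "(x, y) \<in> R" "(x, z) \<in> R" "y \<le> z" for x y z
    using assms that unfolding saturated_on_def by blast
  have restr: "((min a x, min b y), (x, y)) \<in> R" if "((a, b), (c, d)) \<in> R" "x \<le> c" "y \<le> d" for a b c d x y
  proof -
    have "(x, y) \<in> {..m} \<times> {..n}" using bnd[OF that(1)] that by auto
    then have "(inf (a, b) (x, y), (x, y)) \<in> R"
      by (rule restr0[OF that(1)]) (simp add: that)
    then show ?thesis by (simp add: inf_min)
  qed
  have sat: "((c, d), (e, f)) \<in> R"
    if "((a, b), (c, d)) \<in> R" "((a, b), (e, f)) \<in> R" "c \<le> e" "d \<le> f" for a b c d e f
    by (rule sat0[OF that(1,2)]) (simp add: that)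
  \<comment> \<open>At \<open>i = 0\<close> the pair is a loop, as \<open>i - 1 = 0\<close>; this
    value disappears when \<open>h\<close> is restricted to \<open>{1..m}\<close>.\<close>
  have "\<exists>k\<le>n + 1. \<forall>j. ((i - 1, j), (i, j)) \<in> R \<longleftrightarrow> j < k" for i
  proof (rule downward_closed_eq_lessThan)
    show "((i - 1, j), (i, j)) \<in> R" if "((i - 1, k), (i, k)) \<in> R" "j \<le> k" for j k
      using restr[OF that(1), of i j] that by (simp add: min_absorb1 min_absorb2)
    show "j \<le> n" if "((i - 1, j), (i, j)) \<in> R" for j using bnd[OF that] by simp
  qed
  then obtain h where h: "\<And>i. h i \<le> n + 1" "\<And>i j. ((i - 1, j), (i, j)) \<in> R \<longleftrightarrow> j < h i" by metis
  have "\<exists>k\<le>m + 1. \<forall>i. ((i, j), (i, j + 1)) \<in> R \<longleftrightarrow> i < k" for j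
  proof (rule downward_closed_eq_lessThan)
    show "((i, j), (i, j + 1)) \<in> R" if "((k, j), (k, j + 1)) \<in> R" "i \<le> k" for i k
      using restr[OF that(1), of i "j + 1"] that by (simp add: min_absorb1 min_absorb2)
    show "i \<le> m" if "((i, j), (i, j + 1)) \<in> R" for i using bnd[OF that] by simp
  qed
  then obtain v where v: "\<And>j. v j \<le> m + 1" "\<And>i j. ((i, j), (i, j + 1)) \<in> R \<longleftrightarrow> i < v j" by metis
  \<comment> \<open>Otherwise the lower and right edges compose to the diagonal of the square, and
    saturation with the left edge yields the upper edge, contradicting
    \<open>h i = j + 1\<close>.\<close>
  have hv: "v j \<le> i" if "h i = j + 1" "i \<in> {1..m}" "j < n" for i j
  proof (rule ccontr)
    assume "\<not> v j \<le> i"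
    then have R: "((i, j), (i, j + 1)) \<in> R" "((i - 1, j), (i, j + 1)) \<in> R"
      using v(2)[of i j] h(2)[of i j] that(1) by (auto intro: transD[OF trans])
    have "((i - 1, j), (i - 1, j + 1)) \<in> R"
      using v(2) \<open>\<not> v j \<le> i\<close> by simp
    then have "((i - 1, j + 1), (i, j + 1)) \<in> R" using sat[OF _ R(2)] by simp
    then show False using h(2) that(1) by simp
  qed
  \<comment> \<open>Otherwise the left and upper edges compose to the diagonal, and saturation with
    the lower edge yields the right edge, contradicting \<open>v j = i\<close>.\<close>
  have vh: "h i \<le> j + 1" if "v j = i" "i \<in> {1..m}" "j < n" for i j
  proof (rule ccontr)
    assume "\<not> h i \<le> j + 1"
    then have R: "((i - 1, j + 1), (i, j + 1)) \<in> R" "((i - 1, j), (i, j)) \<in> R"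
      using h(2)[of i j] h(2)[of i "j + 1"] by simp_all
    have "((i - 1, j), (i - 1, j + 1)) \<in> R" using v(2) that by simp
    then have "((i - 1, j), (i, j + 1)) \<in> R" using R(1) by (rule transD[OF trans])
    then have "((i, j), (i, j + 1)) \<in> R" using sat[OF R(2)] by simp
    then show False using v(2) that(1) by simp
  qed
  let ?x = "(restrict h {1..m}, restrict v {..<n})"
  have *: "\<forall>i\<in>{1..m}. \<forall>j<n. (h i = j + 1 \<longrightarrow> v j \<le> i) \<and> (v j = i \<longrightarrow> h i \<le> j + 1)"
    using hv vh by blast
  have "v j \<in> insert 0 (insert (m + 1) {1..m})" for j
    using v(1)[of j] by auto
  then have "?x \<in> codes m {1..m} n"
    unfolding codes_def using h(1) * by simp
  moreover have "((a, b), (c, d)) \<in> R \<longleftrightarrow> ((a, b), (c, d)) \<in> rel_of m n ?x" for a b c d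
  proof
    assume R: "((a, b), (c, d)) \<in> R"
    note B = bnd[OF R]
    \<comment> \<open>Restriction relates \<open>(a, b)\<close> to every point of the rectangle, so
      saturation at two neighbouring points yields the unit edge between them.\<close>
    have low: "((a, b), (x, y)) \<in> R" if "a \<le> x" "x \<le> c" "b \<le> y" "y \<le> d" for x y
      using restr[OF R, of x y] that by (simp add: min_absorb1 min_absorb2)
    have "d < h i" if "a < i" "i \<le> c" for i
      using sat[OF low[of "i - 1" d] low[of i d]] that B by (simp add: h(2)[symmetric])
    moreover have "c < v j" if "b \<le> j" "j < d" for j
      using sat[OF low[of c j] low[of c "j + 1"]] that B by (simp add: v(2)[symmetric])
    ultimately show "((a, b), (c, d)) \<in> rel_of m n ?x"
      using B by (simp add: mem_rel_of)
  next
    assume R: "((a, b), (c, d)) \<in> rel_of m n ?x"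
    \<comment> \<open>The path follows the lower side and then the right side; the lower edges are
      present because \<open>b \<le> d < h i\<close>.\<close>
    have "((a, b), (c, b)) \<in> R"
    proof (rule trans_chain[where f = "\<lambda>i. (i, b)", OF trans])
      show "((i - 1, b), (i, b)) \<in> R" if "a < i" "i \<le> c" for i
      proof -
        have H: "\<forall>i\<in>{a<..c}. d < restrict h {1..m} i" "b \<le> d" "c \<le> m"
          using R unfolding mem_rel_of by blast+
        have "d < restrict h {1..m} i" using that by (intro bspec[OF H(1)]) simp
        moreover have "i \<in> {1..m}" using H(3) that by simp
        ultimately have "b \<le> d" "d < h i" using H(2) by simp_all
        then show ?thesis using h(2)[of i b] by simp
      qed
    qed (use R refl in \<open>auto simp: mem_rel_of\<close>)
    moreover have "((c, b), (c, d)) \<in> R"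
    proof (rule trans_chain[where f = "\<lambda>j. (c, j)", OF trans])
      show "((c, j - 1), (c, j)) \<in> R" if "b < j" "j \<le> d" for j
      proof -
        have H: "\<forall>j\<in>{b..<d}. c < restrict v {..<n} j" "d \<le> n"
          using R unfolding mem_rel_of by blast+
        have "c < restrict v {..<n} (j - 1)" using that by (intro bspec[OF H(1)]) auto
        moreover have "j - 1 \<in> {..<n}" using H(2) that by auto
        ultimately have "c < v (j - 1)" by simp
        then show ?thesis using v(2)[of c "j - 1"] that by simp
      qed
    qed (use R refl in \<open>auto simp: mem_rel_of\<close>)
    ultimately show "((a, b), (c, d)) \<in> R" by (rule transD[OF trans])
  qed
  ultimately show ?thesis by (intro bexI[of _ ?x]) (auto simp del: One_nat_def)
qed

lemma eq_from_less_iff: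
  fixes a b N :: nat
  assumes "\<And>k. k \<le> N \<Longrightarrow> k < a \<longleftrightarrow> k < b" "a \<le> N + 1" "b \<le> N + 1"
  shows "a = b"
  using assms(1)[of a] assms(1)[of b] assms(2,3) by (cases a b rule: linorder_cases) auto

text \<open>A code can be read off from the unit edges of its relation: row \<open>j\<close> has
  horizontal step \<open>i\<close> exactly when \<open>j < h i\<close>, and dually for
  \<open>v\<close>.\<close>

lemma inj_on_rel_of: "inj_on (rel_of m n) (codes m {1..m} n)"
proof (rule inj_onI)
  fix x y assume x: "x \<in> codes m {1..m} n" and y: "y \<in> codes m {1..m} n" and eq: "rel_of m n x = rel_of m n y"
  obtain h v h' v' where xy: "x = (h, v)" "y = (h', v')" by (cases x, cases y)
  have h: "h \<in> {1..m} \<rightarrow>\<^sub>E {..n + 1}" "h' \<in> {1..m} \<rightarrow>\<^sub>E {..n + 1}"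
    and v: "v \<in> {..<n} \<rightarrow>\<^sub>E insert 0 (insert (m + 1) {1..m})" "v' \<in> {..<n} \<rightarrow>\<^sub>E insert 0 (insert (m + 1) {1..m})"
    using x y by (simp_all add: xy codes_def)
  have "j < h i \<longleftrightarrow> j < h' i" if "i \<in> {1..m}" "j \<le> n" for i j
  proof -
    have "{i - 1<..i} = {i}" using that by auto
    then have "((i - 1, j), (i, j)) \<in> rel_of m n (g, w) \<longleftrightarrow> j < g i" for g w
      using that by (simp add: mem_rel_of)
    then show ?thesis using eq by (metis xy)
  qed
  moreover have "h i \<le> n + 1" "h' i \<le> n + 1" if "i \<in> {1..m}" for i using h that by (auto dest: PiE_mem)
  ultimately have "h i = h' i" if "i \<in> {1..m}" for i
    using that by (intro eq_from_less_iff[of n]) simp_all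
  then have 1: "h = h'" using h by (rule PiE_ext[rotated 2])
  have "i < v j \<longleftrightarrow> i < v' j" if "j < n" "i \<le> m" for i j
  proof -
    have "((i, j), (i, j + 1)) \<in> rel_of m n (g, w) \<longleftrightarrow> i < w j" for g w
      using that by (simp add: mem_rel_of)
    then show ?thesis using eq by (metis xy)
  qed
  moreover have "v j \<le> m + 1" "v' j \<le> m + 1" if "j < n" for j
    using PiE_mem[OF v(1), of j] PiE_mem[OF v(2), of j] that by auto
  ultimately have "v j = v' j" if "j \<in> {..<n}" for j
    using that by (intro eq_from_less_iff[of m]) simp_all
  then have 2: "v = v'" using v by (rule PiE_ext[rotated 2])
  show "x = y" using 1 2 by (simp add: xy)
qed

lemma card_saturated_grid:
  "card {R. saturated_on ({..m} \<times> {..n}) (\<le>) inf R} = card (codes m {1..m} n)"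
proof -
  have "{R. saturated_on ({..m} \<times> {..n}) (\<le>) inf R} = rel_of m n ` codes m {1..m} n"
    using saturated_imp_rel_of saturated_rel_of by fastforce
  then show ?thesis by (simp add: card_image inj_on_rel_of del: One_nat_def)
qed

subsection \<open>Subgroups of a finite cyclic group\<close>

text \<open>For \<open>d\<close> dividing a positive \<open>N\<close>, the subgroup generated by
  \<open>d\<close>, of order \<open>N div d\<close>.\<close>

definition multiples :: "nat \<Rightarrow> nat \<Rightarrow> int set"
  where "multiples N d = {x \<in> {0..<int N}. int d dvd x}"

lemma subgroup_multiples:
  assumes "N > 0" "d dvd N"
  shows "subgroup (multiples N d) (integer_mod_group N)"
proof -
  have dN: "int d dvd int N" using assms by simp
  interpret group "integer_mod_group N" by simp
  show ?thesis
  proof (rule subgroupI)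
    show "multiples N d \<subseteq> carrier (integer_mod_group N)"
      using assms by (auto simp: multiples_def carrier_integer_mod_group)
    then show "inv\<^bsub>integer_mod_group N\<^esub> x \<in> multiples N d" if "x \<in> multiples N d" for x
      using assms that dN by (subst inv_integer_mod_group) (auto simp: multiples_def dvd_mod)
    show "x \<otimes>\<^bsub>integer_mod_group N\<^esub> y \<in> multiples N d" if "x \<in> multiples N d" "y \<in> multiples N d" for x y
      using assms that dN by (auto simp: multiples_def dvd_mod)
    have "0 \<in> multiples N d" using assms by (simp add: multiples_def)
    then show "multiples N d \<noteq> {}" by blast
  qed
qed

text \<open>The preimage \<open>K\<close> of \<open>H\<close> in the integers is an ideal containing
  \<open>N\<close>. By division with remainder, its least positive element \<open>d\<close>
  generates it.\<close>

lemma subgroup_eq_multiples: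
  assumes "N > 0" "subgroup H (integer_mod_group N)"
  shows "\<exists>d. d dvd N \<and> H = multiples N d"
proof -
  interpret group "integer_mod_group N" by simp
  have sub: "H \<subseteq> {0..<int N}"
    using subgroup.subset[OF assms(2)] assms(1) by (simp add: carrier_integer_mod_group)
  define K where "K = {x::int. x mod int N \<in> H}"
  have zero: "0 \<in> H" using subgroup.one_closed[OF assms(2)] by simp
  have N: "int N \<in> K" using zero by (simp add: K_def)
  have power: "x [^]\<^bsub>integer_mod_group N\<^esub> (k::int) \<in> H" if "x \<in> H" for x k
    using subgroup_int_pow_closed[OF assms(2) that] .
  have mult: "k * x \<in> K" if "x \<in> K" for x k
    using power[of "x mod int N" k] that by (simp add: K_def int_pow_integer_mod_group mod_mult_right_eq)
  have add: "x + y \<in> K" if "x \<in> K" "y \<in> K" for x y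
    using subgroup.m_closed[OF assms(2), of "x mod int N" "y mod int N"] that by (simp add: K_def mod_add_eq)
  define d where "d = (LEAST d. d > 0 \<and> int d \<in> K)"
  have d: "d > 0" "int d \<in> K"
    using LeastI[of "\<lambda>d. d > 0 \<and> int d \<in> K" N] assms(1) N by (simp_all add: d_def)
  have "x \<in> K \<longleftrightarrow> int d dvd x" for x
  proof
    assume x: "x \<in> K"
    have "x mod int d = x + - (x div int d) * int d" by (simp add: minus_div_mult_eq_mod [symmetric])
    then have "x mod int d \<in> K" using add[OF x mult[OF d(2)]] by metis
    moreover have "0 \<le> x mod int d" "x mod int d < int d" using d by simp_all
    moreover have "\<not> (nat (x mod int d) > 0 \<and> int (nat (x mod int d)) \<in> K)"
      using not_less_Least[of "nat (x mod int d)" "\<lambda>d. d > 0 \<and> int d \<in> K"] d calculation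
      unfolding d_def[symmetric] by linarith
    ultimately show "int d dvd x" by (simp add: dvd_eq_mod_eq_0)
  next
    assume "int d dvd x"
    then show "x \<in> K" using mult[OF d(2)] by (metis dvdE mult.commute)
  qed
  note K = this
  have "d dvd N" using K[of "int N"] N by simp
  moreover have "H = multiples N d"
  proof (rule Set.set_eqI)
    fix x
    have "x \<in> H \<longleftrightarrow> x \<in> K" if "x \<in> {0..<int N}" using that by (simp add: K_def)
    then show "x \<in> H \<longleftrightarrow> x \<in> multiples N d" using K[of x] sub unfolding multiples_def by blast
  qed
  ultimately show ?thesis by blast
qed

lemma Sub_integer_mod_group:
  "N > 0 \<Longrightarrow> Sub (integer_mod_group N) = multiples N ` {d. d dvd N}"
  unfolding Sub_def using subgroup_multiples subgroup_eq_multiples by blast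

text \<open>Inclusion is tested on the element \<open>d\<close>. The exception is
  \<open>d = N\<close>, which is not a representative, but there \<open>e dvd N\<close> is
  assumed.\<close>

lemma multiples_subset_iff:
  assumes "N > 0" "d dvd N" "e dvd N"
  shows "multiples N d \<subseteq> multiples N e \<longleftrightarrow> e dvd d"
proof
  assume sub: "multiples N d \<subseteq> multiples N e"
  have "d \<le> N" using assms by (simp add: dvd_imp_le)
  show "e dvd d"
  proof (cases "d = N")
    case False
    then have "int d \<in> multiples N d" using \<open>d \<le> N\<close> by (simp add: multiples_def)
    then have "int d \<in> multiples N e" using sub by blast
    then show ?thesis by (simp add: multiples_def)
  qed (use assms in simp)
next
  assume "e dvd d"
  then have "int e dvd int d" by simp
  then have "int e dvd x" if "int d dvd x" for x using that by (rule dvd_trans)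
  then show "multiples N d \<subseteq> multiples N e" unfolding multiples_def by blast
qed

text \<open>The exponents are complemented so that \<open>(a, b)\<close> in the grid gives the
  subgroup of order \<open>p ^ a * q ^ b\<close>, and larger points give larger subgroups.\<close>

definition grid_subgroup :: "nat \<Rightarrow> nat \<Rightarrow> nat \<Rightarrow> nat \<Rightarrow> nat \<times> nat \<Rightarrow> int set"
  where "grid_subgroup p q m n = (\<lambda>(a, b). multiples (p ^ m * q ^ n) (p ^ (m - a) * q ^ (n - b)))"

lemma dvd_prime_power_product_iff:
  fixes p q :: nat
  assumes "prime p" "prime q" "p \<noteq> q"
  shows "p ^ a * q ^ b dvd p ^ c * q ^ d \<longleftrightarrow> a \<le> c \<and> b \<le> d"
proof
  have cop: "coprime (p ^ i) (q ^ j)" for i j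
    using primes_coprime[OF assms] by simp
  then have cop': "coprime (q ^ j) (p ^ i)" for i j
    by (simp add: coprime_commute)
  assume dv: "p ^ a * q ^ b dvd p ^ c * q ^ d"
  then have "p ^ a dvd p ^ c * q ^ d" "q ^ b dvd p ^ c * q ^ d"
    using dvd_mult_left dvd_mult_right by blast+
  then have "p ^ a dvd p ^ c" "q ^ b dvd q ^ d"
    by (simp_all add: coprime_dvd_mult_left_iff[OF cop] coprime_dvd_mult_right_iff[OF cop'])
  then show "a \<le> c \<and> b \<le> d"
    using power_dvd_imp_le prime_gt_1_nat[OF assms(1)] prime_gt_1_nat[OF assms(2)] by blast
qed (auto intro: mult_dvd_mono le_imp_power_dvd)

lemma dvd_prime_power_productE:
  fixes p q :: nat
  assumes "prime p" "prime q" "x dvd p ^ m * q ^ n"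
  obtains a b where "a \<le> m" "b \<le> n" "x = p ^ a * q ^ b"
proof -
  obtain y z where "x = y * z" "y dvd p ^ m" "z dvd q ^ n"
    using division_decomp[OF assms(3)] by blast
  moreover from this obtain a b where "a \<le> m" "y = p ^ a" "b \<le> n" "z = q ^ b"
    using divides_primepow_nat[OF assms(1)] divides_primepow_nat[OF assms(2)] by auto
  ultimately show ?thesis using that[of a b] by simp
qed

lemma grid_subgroup_subset_iff:
  assumes pq: "prime p" "prime q" "p \<noteq> q"
    and "x \<in> {..m} \<times> {..n}" "y \<in> {..m} \<times> {..n}"
  shows "grid_subgroup p q m n x \<subseteq> grid_subgroup p q m n y \<longleftrightarrow> fst x \<le> fst y \<and> snd x \<le> snd y"
proof -
  obtain a b c d where xy: "x = (a, b)" "y = (c, d)" by (cases x, cases y)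
  have N: "p ^ m * q ^ n > 0" using pq by (simp add: prime_gt_0_nat)
  show ?thesis
    using multiples_subset_iff[OF N, of "p ^ (m - a) * q ^ (n - b)" "p ^ (m - c) * q ^ (n - d)"] assms(4,5)
    unfolding xy grid_subgroup_def prod.case dvd_prime_power_product_iff[OF pq] by auto
qed

text \<open>By coprimality, membership splits into one condition per prime. Intersecting imposes the
  larger exponent, and complementing turns this maximum into a minimum.\<close>

lemma grid_subgroup_inter:
  assumes pq: "prime p" "prime q" "p \<noteq> q"
    and "x \<in> {..m} \<times> {..n}" "y \<in> {..m} \<times> {..n}"
  shows "grid_subgroup p q m n x \<inter> grid_subgroup p q m n y
    = grid_subgroup p q m n (min (fst x) (fst y), min (snd x) (snd y))"
proof -
  obtain a b c d where xy: "x = (a, b)" "y = (c, d)" by (cases x, cases y)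
  have cop: "coprime (int p ^ i) (int q ^ j)" for i j
    using primes_coprime[OF pq] by simp
  have split: "int p ^ i * int q ^ j dvd z \<longleftrightarrow> int p ^ i dvd z \<and> int q ^ j dvd z" for i j z
    by (intro iffI conjI; (elim conjE)?) (erule dvd_mult_left, erule dvd_mult_right, erule (1) divides_mult, rule cop)
  have both: "int r ^ (k - i) dvd z \<and> int r ^ (k - j) dvd z \<longleftrightarrow> int r ^ (k - min i j) dvd z" for r i j k z
  proof -
    have "k - min i j = max (k - i) (k - j)" by auto
    then show ?thesis
      by (metis dvd_trans le_imp_power_dvd max.cobounded1 max.cobounded2 max_def)
  qed
  show ?thesis
  proof (rule Set.set_eqI)
    fix z
    show "z \<in> grid_subgroup p q m n x \<inter> grid_subgroup p q m n y \<longleftrightarrow>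
        z \<in> grid_subgroup p q m n (min (fst x) (fst y), min (snd x) (snd y))"
      unfolding xy grid_subgroup_def multiples_def prod.case fst_conv snd_conv Int_iff mem_Collect_eq
        of_nat_mult of_nat_power split both[symmetric]
      by blast
  qed
qed

text \<open>Injectivity is antisymmetry of inclusion; surjectivity holds because each subgroup comes
  from a divisor of \<open>p ^ m * q ^ n\<close>.\<close>

lemma bij_betw_grid_subgroup:
  assumes pq: "prime p" "prime q" "p \<noteq> q"
  shows "bij_betw (grid_subgroup p q m n) ({..m} \<times> {..n}) (Sub (integer_mod_group (p ^ m * q ^ n)))"
proof -
  have N: "p ^ m * q ^ n > 0" using pq by (simp add: prime_gt_0_nat)
  have "inj_on (grid_subgroup p q m n) ({..m} \<times> {..n})"
  proof (rule inj_onI)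
    fix x y assume xy: "x \<in> {..m} \<times> {..n}" "y \<in> {..m} \<times> {..n}"
      and "grid_subgroup p q m n x = grid_subgroup p q m n y"
    then have "fst x \<le> fst y \<and> snd x \<le> snd y" "fst y \<le> fst x \<and> snd y \<le> snd x"
      using grid_subgroup_subset_iff[OF pq xy] grid_subgroup_subset_iff[OF pq xy(2,1)] by auto
    then show "x = y" by (simp add: prod_eq_iff)
  qed
  moreover have "grid_subgroup p q m n ` ({..m} \<times> {..n}) = multiples (p ^ m * q ^ n) ` {d. d dvd p ^ m * q ^ n}"
  proof (intro equalityI subsetI)
    fix H assume "H \<in> grid_subgroup p q m n ` ({..m} \<times> {..n})"
    then show "H \<in> multiples (p ^ m * q ^ n) ` {d. d dvd p ^ m * q ^ n}"
      by (auto simp: grid_subgroup_def dvd_prime_power_product_iff[OF pq])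
  next
    fix H assume "H \<in> multiples (p ^ m * q ^ n) ` {d. d dvd p ^ m * q ^ n}"
    then obtain e where e: "e dvd p ^ m * q ^ n" "H = multiples (p ^ m * q ^ n) e" by auto
    obtain a b where ab: "a \<le> m" "b \<le> n" "e = p ^ a * q ^ b"
      using dvd_prime_power_productE[OF pq(1,2) e(1)] .
    then have "H = grid_subgroup p q m n (m - a, n - b)" by (simp add: grid_subgroup_def e(2))
    then show "H \<in> grid_subgroup p q m n ` ({..m} \<times> {..n})" by auto
  qed
  ultimately show ?thesis by (simp add: bij_betw_def Sub_integer_mod_group[OF N])
qed

section \<open>From transfer systems to saturated relations on the grid\<close>

lemma transfer_system_iff:
  "transfer_system G R \<longleftrightarrow>
    R \<subseteq> {(K, H). K \<in> Sub G \<and> H \<in> Sub G \<and> K \<subseteq> H} \<and> (\<forall>H\<in>Sub G. (H, H) \<in> R) \<and> trans R \<and>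
    (\<forall>K H. \<forall>M\<in>Sub G. (K, H) \<in> R \<and> M \<subseteq> H \<longrightarrow> (K \<inter> M, M) \<in> R)"
proof -
  have "(\<forall>L K H. (L, K) \<in> R \<and> (K, H) \<in> R \<longrightarrow> (L, H) \<in> R) \<longleftrightarrow> trans R"
    unfolding trans_def by blast
  then show ?thesis unfolding transfer_system_def by (simp only:)
qed

lemma saturated_transfer_system_iff:
  "saturated_transfer_system G R \<longleftrightarrow> saturated_on (Sub G) (\<subseteq>) (\<inter>) R"
proof -
  have "saturated_transfer_system G R \<longleftrightarrow> transfer_system G R \<and>
      (\<forall>x y z. (x, y) \<in> R \<and> (x, z) \<in> R \<and> y \<subseteq> z \<longrightarrow> (y, z) \<in> R)"
  proof (intro iffI conjI)
    assume R: "saturated_transfer_system G R"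
    then show t: "transfer_system G R" by (simp add: saturated_transfer_system_def)
    have sub: "x \<in> Sub G" "y \<in> Sub G" "x \<subseteq> y" if "(x, y) \<in> R" for x y
      using t that by (auto simp: transfer_system_iff)
    have sat: "(y, z) \<in> R" if "x \<in> Sub G" "y \<in> Sub G" "z \<in> Sub G" "x \<subseteq> y" "y \<subseteq> z" "(x, y) \<in> R" "(x, z) \<in> R" for x y z
      using R that unfolding saturated_transfer_system_def by meson
    show "\<forall>x y z. (x, y) \<in> R \<and> (x, z) \<in> R \<and> y \<subseteq> z \<longrightarrow> (y, z) \<in> R"
    proof (intro allI impI, elim conjE)
      fix x y z assume xyz: "(x, y) \<in> R" "(x, z) \<in> R" "y \<subseteq> z"
      then show "(y, z) \<in> R" by (intro sat[OF sub(1,2)[OF xyz(1)] sub(2)[OF xyz(2)] sub(3)[OF xyz(1)]])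
    qed
  next
    assume R: "transfer_system G R \<and> (\<forall>x y z. (x, y) \<in> R \<and> (x, z) \<in> R \<and> y \<subseteq> z \<longrightarrow> (y, z) \<in> R)"
    then have t: "transfer_system G R" and sat: "\<And>x y z. (x, y) \<in> R \<Longrightarrow> (x, z) \<in> R \<Longrightarrow> y \<subseteq> z \<Longrightarrow> (y, z) \<in> R"
      by (blast, blast)
    have tr: "trans R" using t by (simp add: transfer_system_iff)
    \<comment> \<open>Restrict the pair \<open>(L, H)\<close> to \<open>K\<close>, where
      \<open>L \<inter> K\<close> is just \<open>L\<close>.\<close>
    have "(L, K) \<in> R" if "(L, H) \<in> R" "L \<subseteq> K" "K \<subseteq> H" "K \<in> Sub G" for L K H
    proof -
      have "(L \<inter> K, K) \<in> R" using t that unfolding transfer_system_def by meson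
      then show ?thesis using that(2) by (simp add: Int_absorb2)
    qed
    then show "saturated_transfer_system G R"
      unfolding saturated_transfer_system_def
      by (intro conjI ballI impI; (elim conjE)?) (rule t, erule (2) sat, erule (1) transD[OF tr], blast)
  qed
  then show ?thesis unfolding transfer_system_iff saturated_on_def by (simp only: conj_assoc)
qed

text \<open>Transfer systems become relations on the grid and then codes on \<open>{1..m}\<close>.
  The value is free of \<open>p\<close> and \<open>q\<close>, and the theorem becomes the defining
  equation of \<open>num_codes\<close>.\<close>

lemma num_saturated_eq:
  assumes "prime p" "prime q" "p \<noteq> q"
  shows "num_saturated p q m n = num_codes n m"
proof -
  have "num_saturated p q m n =
      card {R. saturated_on (Sub (integer_mod_group (p ^ m * q ^ n))) (\<subseteq>) (\<inter>) R}"
    by (simp add: num_saturated_def saturated_transfer_system_iff)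
  also have "\<dots> = card {R. saturated_on ({..m} \<times> {..n}) (\<le>) inf R}"
  proof (rule card_saturated_on_transport[OF bij_betw_grid_subgroup[OF assms]])
    fix x y assume xy: "x \<in> {..m} \<times> {..n}" "y \<in> {..m} \<times> {..n}"
    show "grid_subgroup p q m n x \<subseteq> grid_subgroup p q m n y \<longleftrightarrow> x \<le> y"
      using grid_subgroup_subset_iff[OF assms xy] by (simp add: less_eq_prod_def)
    show "inf x y \<in> {..m} \<times> {..n} \<and>
        grid_subgroup p q m n (inf x y) = grid_subgroup p q m n x \<inter> grid_subgroup p q m n y"
      using grid_subgroup_inter[OF assms xy] xy by (auto simp: inf_prod_def inf_min)
  qed
  also have "\<dots> = num_codes n m"
    using card_codes[of "{1..m}" m n] by (simp add: card_saturated_grid)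
  finally show ?thesis .
qed

theorem theorem4p1:
  fixes p q m n :: nat
  assumes "prime p" and "prime q" and "p \<noteq> q"
  shows "num_saturated p q m (n + 1) =
    num_saturated p q m n + (\<Sum>k = 0..m. ((m + 1) choose k) * num_saturated p q k n)"
  by (simp add: num_saturated_eq[OF assms])

end
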